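(* For every nonnegative integer $k$ and every integer $n\ge\frac{k+7}{2}$, the difference $\mathrm{av}_{n+1}^k(1324,1342)-\mathrm{av}_n^k(1324,1342)$ is nonnegative, and equals the coefficient of $x^k$ in the generating function $$x^{n-1}(2+2x)\,C_{1324,1342}(x)=x^{n-1}(2+2x)\cdot\prod_{i\ge 1}\frac{1+x^i}{1-x^i}.$$ In particular, when $n\ge\frac{k+7}{2}$, $$\mathrm{av}_n^k(1324,1342)=[x^k]\left(\frac{1-x-x^{n-1}(2+2x)}{1-x}\cdot\prod_{i\ge 1}\frac{1+x^i}{1-x^i}\right).$$
   Context: $\mathrm{av}_n^k(B)$ is the number of permutations in $S_n$ with exactly $k$ inversions (pairs $i<j$ with $\pi_i>\pi_j$) that avoid every pattern in $B$; a permutation avoids a pattern $q$ if it has no subsequence order-isomorphic to $q$. $[x^k]F(x)$ denotes the coefficient of $x^k$ in the formal power series $F$. If for every $k\ge0$ there are constants $m_k,c_k(B)$ with $\mathrm{av}_n^k(B)=c_k(B)$ for all $n\ge m_k$, then $C_B(x)=\sum_{k\ge 0}c_k(B)x^k$ is the limit generating function of $B$. *)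

theory Defs
  imports
    "HOL-Analysis.Infinite_Products"
    "HOL-Computational_Algebra.Formal_Power_Series"
    "HOL-Combinatorics.Multiset_Permutations"
    "HOL-Library.Sublist"
begin

(* Permutations in S_n are written in one-line notation, as the members of
   permutations_of_set {1..n}.  List indices start at 0. *)

definition inversions :: "nat list \<Rightarrow> (nat \<times> nat) set" where
  "inversions p = {(i, j). i < j \<and> j < length p \<and> p ! i > p ! j}"

definition order_isomorphic :: "nat list \<Rightarrow> nat list \<Rightarrow> bool" where
  "order_isomorphic s q \<longleftrightarrow>
     length s = length q \<and>
     (\<forall>i < length q. \<forall>j < length q. s ! i < s ! j \<longleftrightarrow> q ! i < q ! j)"

(* The subsequence need not be contiguous: subseq is the scattered sublist relation. *)
definition avoids :: "nat list \<Rightarrow> nat list \<Rightarrow> bool" where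
  "avoids p q \<longleftrightarrow> \<not> (\<exists>s. subseq s p \<and> order_isomorphic s q)"

definition av :: "nat \<Rightarrow> nat \<Rightarrow> nat list set \<Rightarrow> nat" where
  "av n k B =
     card {p \<in> permutations_of_set {1..n}. card (inversions p) = k \<and> (\<forall>q \<in> B. avoids p q)}"

definition has_limit_gf :: "nat list set \<Rightarrow> bool" where
  "has_limit_gf B \<longleftrightarrow> (\<forall>k. \<exists>c m. \<forall>n \<ge> m. av n k B = c)"

definition limit_coeff :: "nat list set \<Rightarrow> nat \<Rightarrow> nat" where
  "limit_coeff B k = (THE c. \<exists>m. \<forall>n \<ge> m. av n k B = c)"

(* Meaningful only if has_limit_gf B holds. *)
definition limit_gf :: "nat list set \<Rightarrow> rat fps" where
  "limit_gf B = Abs_fps (\<lambda>k. of_nat (limit_coeff B k))"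

(* The product over i >= 1 of (1 + x^i) / (1 - x^i), reindexed to start at i = 0; the
   limit is taken in the metric topology on formal power series. *)
definition overpartition_factor :: "nat \<Rightarrow> rat fps" where
  "overpartition_factor i = (1 + fps_X ^ Suc i) / (1 - fps_X ^ Suc i)"

end

theory Submission
  imports Defs
begin

text \<open>
  A permutation avoids 1324 and 1342 iff, for every entry, the larger entries to its right avoid 213
  and 231. Building the permutation from right to left, a new first entry with c smaller entries after
  it creates c inversions, and it is admissible iff it is the maximum or c is at least the last
  non-maximal value of c. Hence the values of c form a set D of distinct parts (from new
  maxima) and a weakly monotone sequence, i.e. a partition L: together an overpartition, whose weight
  is the number of inversions. For length m + 1 the pairs (D, L) that occur are those with
  #(parts of L that are at least v) + #(parts of D that exceed v) \<le> m - v for all v \<ge> 1.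
  If the weight is at most 2m - 3, only the conditions for v = 1 and v = m can fail, and not both. Either
  failure is counted by \<open>x^m (1 + x) / (1 - x)\<close> times the generating function of overpartitions: remove
  a part of size at least m in the case v = m, a first column of height at least m in the case v = 1.
\<close>

section \<open>Building avoiders from right to left\<close>

lemma avoids_1324:
  "avoids p [1, 3, 2, 4] \<longleftrightarrow> (\<forall>a b c d. subseq [a, b, c, d] p \<longrightarrow> \<not> (a < c \<and> c < b \<and> b < d))"
proof -
  have iso: "order_isomorphic s [1, 3, 2, 4] \<longleftrightarrow>
      (\<exists>a b c d. s = [a, b, c, d] \<and> a < c \<and> c < b \<and> b < d)" for s
    unfolding order_isomorphic_def
    by (cases s rule: list.exhaust; simp; rename_tac xs; case_tac xs; simp;
        rename_tac xs; case_tac xs; simp; rename_tac xs; case_tac xs; simp)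
       (auto simp: All_less_Suc numeral_eq_Suc)
  show ?thesis
    unfolding avoids_def iso by blast
qed

lemma avoids_1342:
  "avoids p [1, 3, 4, 2] \<longleftrightarrow> (\<forall>a b c d. subseq [a, b, c, d] p \<longrightarrow> \<not> (a < d \<and> d < b \<and> b < c))"
proof -
  have iso: "order_isomorphic s [1, 3, 4, 2] \<longleftrightarrow>
      (\<exists>a b c d. s = [a, b, c, d] \<and> a < d \<and> d < b \<and> b < c)" for s
    unfolding order_isomorphic_def
    by (cases s rule: list.exhaust; simp; rename_tac xs; case_tac xs; simp;
        rename_tac xs; case_tac xs; simp; rename_tac xs; case_tac xs; simp)
       (auto simp: All_less_Suc numeral_eq_Suc)
  show ?thesis
    unfolding avoids_def iso by blast
qed

definition admissible :: "nat list \<Rightarrow> bool" where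
  "admissible p \<longleftrightarrow> avoids p [1, 3, 2, 4] \<and> avoids p [1, 3, 4, 2]"

text \<open>The values x such that the entries \<open>\<ge> x\<close> contain 213 or 231: a new first entry below x is forbidden.\<close>

definition crowded :: "nat list \<Rightarrow> nat set" where
  "crowded p = {x \<in> set p. \<exists>b y z. x \<le> y \<and> y < b \<and> b < z \<and> (subseq [b, y, z] p \<or> subseq [b, z, y] p)}"

definition num_below :: "nat \<Rightarrow> nat list \<Rightarrow> nat" where
  "num_below a p = card {x \<in> set p. x < a}"

lemma subseq_set: "subseq xs ys \<Longrightarrow> set xs \<subseteq> set ys"
  by (auto elim: list_emb_set)

lemma finite_crowded [simp]: "finite (crowded p)"
  by (simp add: crowded_def)

lemma crowded_subset: "crowded p \<subseteq> set p"
  by (auto simp: crowded_def)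

lemma crowded_downward: "x \<in> crowded p \<Longrightarrow> y \<in> set p \<Longrightarrow> y \<le> x \<Longrightarrow> y \<in> crowded p"
  unfolding crowded_def using le_trans by blast

lemma admissible_Nil [simp]: "admissible []"
  unfolding admissible_def avoids_1324 avoids_1342 by simp

text \<open>Both patterns begin with their 1, so an occurrence that is new in \<open>a # s\<close>
  uses \<open>a\<close> as its 1, and its other three entries form a 213 or 231 above
  \<open>a\<close>.\<close>

lemma admissible_Cons:
  assumes "a \<notin> set s"
  shows "admissible (a # s) \<longleftrightarrow> admissible s \<and> (\<forall>x \<in> crowded s. x < a)"
proof -
  have "(\<forall>x \<in> crowded s. x < a) \<longleftrightarrow>
    (\<forall>b y z. a < y \<and> y < b \<and> b < z \<longrightarrow> \<not> subseq [b, y, z] s \<and> \<not> subseq [b, z, y] s)"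
    (is "?L \<longleftrightarrow> ?R")
  proof
    assume L: ?L
    show ?R
    proof (intro allI impI, rule ccontr)
      fix b y z assume *: "a < y \<and> y < b \<and> b < z"
        and "\<not> (\<not> subseq [b, y, z] s \<and> \<not> subseq [b, z, y] s)"
      then have sub: "subseq [b, y, z] s \<or> subseq [b, z, y] s" by blast
      then have "y \<in> set s" using subseq_set by fastforce
      \<comment> \<open>The lowest entry \<open>y\<close> of the occurrence is itself a crowded
        value.\<close>
      with * sub have "y \<in> crowded s" unfolding crowded_def by blast
      with L * show False by fastforce
    qed
  next
    assume R: ?R
    show ?L
    proof (rule ballI, rule ccontr)
      fix x assume x: "x \<in> crowded s" and "\<not> x < a"
      with assms have "a < x" using crowded_subset by (metis linorder_neqE_nat subsetD)
      with x R show False unfolding crowded_def by (auto dest: less_le_trans)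
    qed
  qed
  moreover have "admissible (a # s) \<longleftrightarrow> admissible s \<and>
    (\<forall>b y z. a < y \<and> y < b \<and> b < z \<longrightarrow> \<not> subseq [b, y, z] s \<and> \<not> subseq [b, z, y] s)"
  proof -
    have split: "subseq [c, d, e, f] (a # s) \<longleftrightarrow> subseq [c, d, e, f] s \<or> (c = a \<and> subseq [d, e, f] s)" for c d e f
      by (auto simp: subseq_Cons2_iff dest: subseq_Cons')
    show ?thesis
      unfolding admissible_def avoids_1324 avoids_1342 split by blast
  qed
  ultimately show ?thesis by blast
qed

lemma subseq_pair:
  assumes "x \<in> set s" "y \<in> set s" "x \<noteq> y"
  shows "subseq [x, y] s \<or> subseq [y, x] s"
  using assms by (induction s) (auto simp: subseq_singleton_left)

text \<open>A 213 or 231 starting at \<open>a\<close> needs an entry above \<open>a\<close>, so a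
  new maximum creates none. If some \<open>z > a\<close> exists, every \<open>x < a\<close> in
  \<open>s\<close> forms with \<open>a\<close> and \<open>z\<close> a 213 or a 231, depending on the
  order of \<open>x\<close> and \<open>z\<close>. Old crowded values lie below \<open>a\<close> by
  admissibility.\<close>

lemma crowded_Cons:
  assumes "a \<notin> set s" and "admissible (a # s)"
  shows "crowded (a # s) = (if \<forall>x \<in> set s. x < a then crowded s else {x \<in> set s. x < a})"
proof -
  have below: "\<forall>x \<in> crowded s. x < a"
    using assms by (simp add: admissible_Cons)
  have split: "subseq [b, y, z] (a # s) \<longleftrightarrow> subseq [b, y, z] s \<or> (b = a \<and> subseq [y, z] s)" for b y z
    by (auto simp: subseq_Cons2_iff dest: subseq_Cons')
  have fresh: "x \<in> crowded s"
    if "x \<le> y" "y < b" "b < z" "subseq [b, y, z] s \<or> subseq [b, z, y] s" "x \<in> set s" for x y z b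
    using that unfolding crowded_def by blast
  have sub: "crowded s \<subseteq> crowded (a # s)"
    unfolding crowded_def split by auto
  have le: "x \<in> crowded s \<or> x \<in> set s \<and> x < a \<and> (\<exists>z \<in> set s. a < z)" if "x \<in> crowded (a # s)" for x
  proof -
    from that obtain b y z where *: "x \<in> set (a # s)" "x \<le> y" "y < b" "b < z"
      and "subseq [b, y, z] (a # s) \<or> subseq [b, z, y] (a # s)"
      unfolding crowded_def by blast
    then consider "subseq [b, y, z] s \<or> subseq [b, z, y] s"
      | "b = a" "subseq [y, z] s \<or> subseq [z, y] s"
      unfolding split by blast
    then show ?thesis
    proof cases
      case 1
      then have "y \<in> set s" using subseq_set by fastforce
      then have "y \<in> crowded s" using fresh[of y y b z] * 1 by blast
      then have "x \<noteq> a" using below * by fastforce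
      then show ?thesis using fresh[of x y b z] * 1 by auto
    next
      case 2
      then have "z \<in> set s" using subseq_set by fastforce
      with 2 * show ?thesis by auto
    qed
  qed
  show ?thesis
  proof (cases "\<forall>x \<in> set s. x < a")
    case True
    with le sub show ?thesis by fastforce
  next
    case False
    with assms(1) obtain z where z: "z \<in> set s" "a < z" by (metis linorder_neqE_nat)
    have "x \<in> crowded (a # s)" if "x \<in> set s" "x < a" for x
      using that z subseq_pair[of x s z] unfolding crowded_def split by auto
    moreover have "x \<in> set s \<and> x < a" if "x \<in> crowded (a # s)" for x
      using le[OF that] below crowded_subset by blast
    ultimately show ?thesis using False by auto
  qed
qed

text \<open>\<open>crowded s\<close> and the set of entries below \<open>a\<close> are both initial
  segments of \<open>set s\<close>, so inclusion can be tested by size. Whether \<open>a\<close> may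
  be prepended thus depends only on its number of smaller entries.\<close>

lemma admissible_Cons_iff:
  assumes "a \<notin> set s"
  shows "admissible (a # s) \<longleftrightarrow> admissible s \<and> card (crowded s) \<le> num_below a s"
proof -
  have "(\<forall>x \<in> crowded s. x < a) \<longleftrightarrow> card (crowded s) \<le> num_below a s"
  proof
    assume "\<forall>x \<in> crowded s. x < a"
    then have "crowded s \<subseteq> {x \<in> set s. x < a}" using crowded_subset by blast
    then show "card (crowded s) \<le> num_below a s" unfolding num_below_def by (intro card_mono) auto
  next
    assume le: "card (crowded s) \<le> num_below a s"
    show "\<forall>x \<in> crowded s. x < a"
    proof (rule ccontr)
      assume "\<not> (\<forall>x \<in> crowded s. x < a)"
      then obtain x where x: "x \<in> crowded s" "a \<le> x" by (meson not_less)
      have "{x \<in> set s. x < a} \<subseteq> crowded s"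
        using x crowded_downward by (metis (mono_tags, lifting) less_or_eq_imp_le less_le_trans mem_Collect_eq subsetI)
      moreover have "x \<notin> {x \<in> set s. x < a}" using x by simp
      ultimately have "{x \<in> set s. x < a} \<subset> crowded s" using x(1) by blast
      then have "num_below a s < card (crowded s)"
        unfolding num_below_def by (simp add: psubset_card_mono)
      with le show False by simp
    qed
  qed
  with admissible_Cons[OF assms] show ?thesis by blast
qed

lemma card_inversions_Cons:
  assumes "distinct (a # s)"
  shows "card (inversions (a # s)) = num_below a s + card (inversions s)"
proof -
  have fin: "finite (inversions s)"
    by (rule finite_subset[of _ "{..<length s} \<times> {..<length s}"]) (auto simp: inversions_def)
  let ?J = "{j. j < length s \<and> s ! j < a}"
  have eq: "inversions (a # s) = (\<lambda>j. (0, Suc j)) ` ?J \<union> map_prod Suc Suc ` inversions s"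
  proof (rule set_eqI)
    fix ij :: "nat \<times> nat"
    obtain i j where ij: "ij = (i, j)" by (cases ij)
    show "ij \<in> inversions (a # s) \<longleftrightarrow>
        ij \<in> (\<lambda>j. (0, Suc j)) ` ?J \<union> map_prod Suc Suc ` inversions s"
      unfolding ij by (cases i; cases j) (auto simp: inversions_def image_iff)
  qed
  have "(!) s ` ?J = {x \<in> set s. x < a}"
    by (auto simp: in_set_conv_nth)
  moreover have "inj_on ((!) s) ?J"
    using assms by (auto simp: inj_on_def nth_eq_iff_index_eq)
  ultimately have "card ?J = num_below a s"
    unfolding num_below_def by (metis card_image)
  moreover have "card (map_prod Suc Suc ` inversions s) = card (inversions s)"
    by (rule card_image) (auto simp: inj_on_def)
  ultimately show ?thesis
    unfolding eq using fin
    by (subst card_Un_disjoint) (auto simp: card_image inj_on_def)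
qed

section \<open>Avoiders as overpartitions\<close>

text \<open>The inserted 0 gives the empty multiset the value 0, which is the threshold for
  \<open>c\<close> before any part has been recorded.\<close>

definition largest :: "nat multiset \<Rightarrow> nat" where
  "largest L = Max (insert 0 (set_mset L))"

lemma largest_le_iff: "largest L \<le> u \<longleftrightarrow> (\<forall>x \<in># L. x \<le> u)"
  by (simp add: largest_def)

lemma largest_empty [simp]: "largest {#} = 0"
  by (simp add: largest_def)

lemma largest_add_mset [simp]: "largest (add_mset c L) = max c (largest L)"
  by (cases "L = {#}") (simp_all add: largest_def insert_commute[of 0])

lemma largest_in: "L \<noteq> {#} \<Longrightarrow> 0 \<notin># L \<Longrightarrow> largest L \<in># L \<and> 0 < largest L"
proof -
  assume "L \<noteq> {#}" "0 \<notin># L"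
  then have "largest L \<noteq> 0"
    using largest_le_iff[of L 0] by (metis le_zero_eq multiset_nonemptyE)
  moreover have "largest L \<in> insert 0 (set_mset L)"
    unfolding largest_def by (rule Max_in) auto
  ultimately show ?thesis by auto
qed

text \<open>
  In the last branch c is at least every part of L (for admissible input), so c can be recovered as the
  largest part; the case c = 0 contributes no part.
\<close>

fun overpartition_of :: "nat list \<Rightarrow> nat set \<times> nat multiset" where
  "overpartition_of [] = ({}, {#})"
| "overpartition_of (a # s) =
     (let c = num_below a s; (D, L) = overpartition_of s in
      if c = 0 then (D, L) else if c = length s then (insert c D, L) else (D, add_mset c L))"

text \<open>
  A part of L added when i entries are present is less than i, and D contains the other values of i.
  So the j-th largest part of L must be less than the j-th largest element of \<open>{1..m} - D\<close>; the
  inequalities below express this by counting. The truncated difference m - v excludes parts of L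
  that are at least m.
\<close>

definition fits :: "nat \<Rightarrow> nat set \<times> nat multiset \<Rightarrow> bool" where
  "fits m q \<longleftrightarrow> fst q \<subseteq> {1..m} \<and> 0 \<notin># snd q \<and>
     (\<forall>v \<ge> 1. size (filter_mset ((\<le>) v) (snd q)) + card {d \<in> fst q. v < d} \<le> m - v)"

definition weight :: "nat set \<times> nat multiset \<Rightarrow> nat" where
  "weight q = \<Sum>(fst q) + sum_mset (snd q)"

section \<open>How the fitting condition changes when one entry is added\<close>

lemma num_below_le_length: "num_below a s \<le> length s"
  unfolding num_below_def
  by (rule order_trans[OF card_mono[of "set s"]]) (auto simp: card_length)

lemma num_below_eq_length_iff:
  assumes "distinct s"
  shows "num_below a s = length s \<longleftrightarrow> (\<forall>x \<in> set s. x < a)"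
proof -
  have "num_below a s = length s \<longleftrightarrow> {x \<in> set s. x < a} = set s"
    unfolding num_below_def distinct_card[OF assms, symmetric]
    using card_subset_eq[of "set s" "{x \<in> set s. x < a}"] by fastforce
  then show ?thesis by blast
qed

text \<open>The condition at \<open>v = Suc m\<close> has right-hand side 0.\<close>

lemma fits_largest_le: "fits (Suc m) (D, L) \<Longrightarrow> largest L \<le> m"
proof -
  assume fit: "fits (Suc m) (D, L)"
  then have "size (filter_mset ((\<le>) (Suc m)) L) = 0"
    unfolding fits_def by (elim conjE allE[of _ "Suc m"]) simp
  then show ?thesis
    by (auto simp: largest_le_iff not_less_eq_eq)
qed

text \<open>For \<open>v \<le> m\<close> the new element adds one to both sides of the condition.
  For \<open>v > m\<close> both bounds are 0 and no element of either set exceeds \<open>v\<close>,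
  so both conditions say that \<open>L\<close> has no part of size at least
  \<open>v\<close>.\<close>

lemma fits_insert:
  assumes "Suc m \<notin> D"
  shows "fits (Suc m) (insert (Suc m) D, L) \<longleftrightarrow> fits m (D, L)"
proof -
  have card: "card {d \<in> insert (Suc m) D. v < d} = Suc (card {d \<in> D. v < d})"
    if "D \<subseteq> {1..m}" "v \<le> m" for v
  proof -
    have "{d \<in> insert (Suc m) D. v < d} = insert (Suc m) {d \<in> D. v < d}"
      using that by auto
    moreover have "finite D" using that finite_subset by blast
    ultimately show ?thesis using assms by simp
  qed
  have D: "insert (Suc m) D \<subseteq> {1..Suc m} \<longleftrightarrow> D \<subseteq> {1..m}"
    using assms by (auto simp: subset_iff) (metis le_Suc_eq)
  show ?thesis
  proof
    assume fit: "fits (Suc m) (insert (Suc m) D, L)"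
    then have Dm: "D \<subseteq> {1..m}" using D by (simp add: fits_def)
    have "size (filter_mset ((\<le>) v) L) + card {d \<in> D. v < d} \<le> m - v" if "v \<ge> 1" for v
    proof -
      have *: "size (filter_mset ((\<le>) v) L) + card {d \<in> insert (Suc m) D. v < d} \<le> Suc m - v"
        using fit that by (simp add: fits_def)
      show ?thesis
      proof (cases "v \<le> m")
        case True
        with * card[OF Dm] show ?thesis by simp
      next
        case False
        then have "{d \<in> D. v < d} = {}" using Dm by auto
        moreover from False * have "size (filter_mset ((\<le>) v) L) = 0"
          by simp
        ultimately show ?thesis by (simp only: card.empty add_0 le0)
      qed
    qed
    with fit Dm show "fits m (D, L)" by (simp add: fits_def)
  next
    assume fit: "fits m (D, L)"
    then have Dm: "D \<subseteq> {1..m}" by (simp add: fits_def)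
    have "size (filter_mset ((\<le>) v) L) + card {d \<in> insert (Suc m) D. v < d} \<le> Suc m - v"
      if "v \<ge> 1" for v
    proof -
      have *: "size (filter_mset ((\<le>) v) L) + card {d \<in> D. v < d} \<le> m - v"
        using fit that by (simp add: fits_def)
      show ?thesis
      proof (cases "v \<le> m")
        case True
        with * card[OF Dm] show ?thesis by simp
      next
        case False
        then have "{d \<in> insert (Suc m) D. v < d} = {}" using Dm by auto
        moreover from False * have "size (filter_mset ((\<le>) v) L) = 0" by simp
        ultimately show ?thesis by (simp only: card.empty add_0 le0)
      qed
    qed
    with fit D Dm show "fits (Suc m) (insert (Suc m) D, L)" by (simp add: fits_def)
  qed
qed

text \<open>Let \<open>u\<close> be the largest part. For \<open>v \<le> u \<le> m\<close>, removing
  \<open>u\<close> lowers both sides of the condition by one. For \<open>v > u\<close> only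
  \<open>D\<close> contributes, and \<open>D \<subseteq> {1..m}\<close> already ensures the bound.
  For empty \<open>L\<close> the value 0 is subtracted, which changes nothing.\<close>

lemma fits_Suc:
  assumes "D \<subseteq> {1..m}" and "0 \<notin># L"
  shows "fits (Suc m) (D, L) \<longleftrightarrow> fits m (D, L - {#largest L#}) \<and> largest L \<le> m"
proof -
  have D: "card {d \<in> D. v < d} \<le> m - v" for v
  proof -
    have "{d \<in> D. v < d} \<subseteq> {v<..m}" using assms by auto
    then have "card {d \<in> D. v < d} \<le> card {v<..m}" by (intro card_mono) auto
    then show ?thesis by simp
  qed
  show ?thesis
  proof (cases "L = {#}")
    case True
    have "card {d \<in> D. v < d} \<le> Suc m - v" for v
      using D[of v] by linarith
    with D True assms show ?thesis by (auto simp: fits_def)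
  next
    case False
    define u where "u = largest L"
    define L' where "L' = L - {#u#}"
    have u: "u \<in># L" "0 < u" using largest_in[OF False assms(2)] by (auto simp: u_def)
    then have L: "L = add_mset u L'" by (simp add: L'_def)
    have big: "filter_mset ((\<le>) v) L' = {#}" if "u < v" for v
    proof -
      have "\<forall>x \<in># L. x \<le> u" using largest_le_iff[of L u] by (simp add: u_def)
      with that show ?thesis by (auto simp: L'_def dest: in_diffD)
    qed
    have eq: "size (filter_mset ((\<le>) v) L) + card {d \<in> D. v < d} \<le> Suc m - v \<longleftrightarrow>
        size (filter_mset ((\<le>) v) L') + card {d \<in> D. v < d} \<le> m - v" if "u \<le> m" for v
    proof (cases "v \<le> u")
      case True
      with that show ?thesis by (auto simp: L)
    next
      case False
      with D[of v] show ?thesis by (simp add: L big)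
    qed
    have "u \<le> m" if "fits (Suc m) (D, L)"
      using fits_largest_le[OF that] by (simp add: u_def)
    moreover have "D \<subseteq> {1..Suc m}" using assms(1) by auto
    then have "fits (Suc m) (D, L) \<longleftrightarrow>
        (\<forall>v \<ge> 1. size (filter_mset ((\<le>) v) L) + card {d \<in> D. v < d} \<le> Suc m - v)"
      using assms by (simp add: fits_def)
    moreover have "0 \<notin># L'"
      using assms(2) by (auto simp: L'_def dest: in_diffD)
    then have "fits m (D, L') \<longleftrightarrow>
        (\<forall>v \<ge> 1. size (filter_mset ((\<le>) v) L') + card {d \<in> D. v < d} \<le> m - v)"
      using assms by (simp add: fits_def)
    ultimately show ?thesis
      using eq unfolding u_def[symmetric] L'_def[symmetric] by blast
  qed
qed

section \<open>The bijection between avoiders and fitting pairs\<close>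

lemma bij_betw_num_below:
  fixes A :: "nat set"
  assumes "finite A"
  shows "bij_betw (\<lambda>a. card {x \<in> A. x < a}) A {..<card A}"
proof -
  let ?r = "\<lambda>a. card {x \<in> A. x < a}"
  have less: "?r a < ?r b" if "a \<in> A" "b \<in> A" "a < b" for a b
    using that assms by (intro psubset_card_mono) auto
  have inj: "inj_on ?r A"
    by (rule linorder_inj_onI) (use less in fastforce)+
  have "?r a < card A" if "a \<in> A" for a
    using that assms by (intro psubset_card_mono) auto
  then have "?r ` A \<subseteq> {..<card A}" by auto
  moreover have "card (?r ` A) = card A" using inj by (rule card_image)
  ultimately show ?thesis
    using inj by (simp add: bij_betw_def card_subset_eq)
qed

text \<open>The middle equation drives the induction: it identifies the threshold for the next entry
  with the largest recorded part, so parts are recorded in weakly increasing order. The bound is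
  \<open>length p - 1\<close> because the rightmost entry has no smaller entry after it and records
  nothing.\<close>

lemma overpartition_of_admissible:
  assumes "distinct p" and "admissible p"
  shows "weight (overpartition_of p) = card (inversions p) \<and>
    largest (snd (overpartition_of p)) = card (crowded p) \<and>
    fits (length p - 1) (overpartition_of p)"
  using assms
proof (induction p)
  case Nil
  then show ?case by (simp add: weight_def inversions_def crowded_def fits_def)
next
  case (Cons a s)
  then have s: "a \<notin> set s" "distinct s" "admissible s"
    and c: "card (crowded s) \<le> num_below a s"
    by (simp_all add: admissible_Cons_iff)
  obtain D L where DL: "overpartition_of s = (D, L)" by (cases "overpartition_of s")
  define c where "c = num_below a s"
  have IH: "\<Sum>D + sum_mset L = card (inversions s)" "largest L = card (crowded s)"
    "fits (length s - 1) (D, L)"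
    using Cons.IH s by (simp_all add: DL weight_def)
  have D: "D \<subseteq> {1..length s - 1}" "finite D" and L: "0 \<notin># L"
    using IH(3) finite_subset[of D "{1..length s - 1}"] by (auto simp: fits_def)
  have inv: "card (inversions (a # s)) = c + card (inversions s)"
    using card_inversions_Cons Cons.prems(1) by (simp add: c_def)
  have crowd: "crowded (a # s) = (if c = length s then crowded s else {x \<in> set s. x < a})"
    using crowded_Cons[OF s(1) Cons.prems(2)] num_below_eq_length_iff[OF s(2)] by (simp add: c_def)
  have crowd_c: "card (crowded (a # s)) = (if c = length s then card (crowded s) else c)"
    unfolding crowd c_def num_below_def by simp
  have cle: "c \<le> length s" using num_below_le_length by (simp add: c_def)
  have Lc: "largest L \<le> c" using IH(2) c by (simp add: c_def)
  have ov: "overpartition_of (a # s) =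
      (if c = 0 then (D, L) else if c = length s then (insert c D, L) else (D, add_mset c L))"
    by (simp add: DL Let_def c_def)
  show ?case
  proof (cases "s = []")
    case True
    \<comment> \<open>For a single entry, \<open>c\<close> is both 0 and \<open>length s\<close>;
      the test for 0 comes first, so 0 never enters \<open>D\<close>.\<close>
    then have "c = 0" using cle by simp
    with True ov IH show ?thesis unfolding inv crowd_c by (simp add: weight_def)
  next
    case False
    then obtain m where m: "length s = Suc m" by (cases s) auto
    \<comment> \<open>Since \<open>largest L \<le> c\<close> and \<open>L\<close> has no part 0, the
      value \<open>c = 0\<close> can occur only while \<open>L\<close> is empty.\<close>
    consider "c = Suc m" | "c = 0" "L = {#}" | "0 < c" "c \<le> m"
    proof (cases "c = 0 \<or> c = Suc m")
      case True
      with Lc L largest_in[of L] that show ?thesis by (cases "L = {#}") auto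
    next
      case False
      with cle m that show ?thesis by simp
    qed
    then show ?thesis
    proof cases
      case 1
      then have "Suc m \<notin> D" using D(1) m by auto
      moreover from this have "fits (Suc m) (insert (Suc m) D, L)"
        using fits_insert IH(3) m by simp
      ultimately show ?thesis
        using 1 m IH D(2) unfolding ov inv crowd_c by (simp add: weight_def)
    next
      case 2
      have "fits (Suc m) (D, L)"
        using fits_Suc[of D m L] D L IH(3) m 2 by simp
      then show ?thesis
        using 2 m IH unfolding ov inv crowd_c by (simp add: weight_def)
    next
      case 3
      have largest: "largest (add_mset c L) = c" using Lc by simp
      then have "fits (Suc m) (D, add_mset c L)"
        using fits_Suc[of D m "add_mset c L"] D L IH(3) m 3 by simp
      then show ?thesis
        using 3 m IH(1) largest unfolding ov inv crowd_c by (simp add: weight_def)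
    qed
  qed
qed

lemma fits_0_iff: "fits 0 q \<longleftrightarrow> q = ({}, {#})"
proof
  assume fit: "fits 0 q"
  then have "filter_mset ((\<le>) 1) (snd q) = {#}" and "0 \<notin># snd q"
    by (auto simp: fits_def simp del: filter_mset_eq_mempty_iff)
  then have "snd q = {#}"
    by (metis filter_mset_eq_mempty_iff less_one multiset_nonemptyE not_less)
  with fit show "q = ({}, {#})" by (auto simp: fits_def prod_eq_iff)
qed (auto simp: fits_def)

text \<open>The set \<open>A\<close> is arbitrary because deleting the first entry leaves an
  arrangement of \<open>A - {a}\<close>. The choice of \<open>a\<close> amounts to the choice of its
  rank in \<open>A\<close>, and the last recorded rank can be read off from the pair.\<close>

lemma bij_betw_overpartition_of:
  assumes "finite A" "card A = Suc m"
  shows "bij_betw overpartition_of {p \<in> permutations_of_set A. admissible p} {q. fits m q}"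
  using assms
proof (induction m arbitrary: A)
  case 0
  then obtain a where A: "A = {a}" by (metis One_nat_def card_1_singletonE)
  have "admissible [a]"
    by (simp add: admissible_Cons_iff crowded_def)
  then have "{p \<in> permutations_of_set A. admissible p} = {[a]}"
    by (auto simp: A)
  moreover have "overpartition_of [a] = ({}, {#})"
    by (simp add: num_below_def)
  ultimately show ?case
    by (simp add: bij_betw_def fits_0_iff)
next
  case (Suc m)
  let ?P = "\<lambda>A. {p \<in> permutations_of_set A. admissible p}"
  define r where "r a = card {x \<in> A. x < a}" for a
  have r: "bij_betw r A {..<Suc (Suc m)}"
    using bij_betw_num_below[OF Suc.prems(1)] Suc.prems(2) by (simp add: r_def[abs_def])
  have below: "num_below a s = r a" if "set s = A - {a}" for a s
    unfolding num_below_def r_def that by (rule arg_cong[of _ _ card]) auto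
  have IH: "bij_betw overpartition_of (?P (A - {a})) {q. fits m q}" if "a \<in> A" for a
    using Suc.IH[of "A - {a}"] Suc.prems that by simp
  have step: "set s = A - {a} \<and> length s = Suc m \<and> distinct s \<and> fits m (overpartition_of s) \<and>
      largest (snd (overpartition_of s)) = card (crowded s)"
    if "a \<in> A" "s \<in> ?P (A - {a})" for a s
    using that overpartition_of_admissible[of s] Suc.prems
    by (auto simp: permutations_of_set_def distinct_card[symmetric])
  have Cons: "a # s \<in> ?P A \<longleftrightarrow> a \<in> A \<and> s \<in> ?P (A - {a}) \<and>
      largest (snd (overpartition_of s)) \<le> r a" for a s
  proof (cases "a \<in> A \<and> s \<in> permutations_of_set (A - {a})")
    case True
    then have "set s = A - {a}" "distinct s" by (auto simp: permutations_of_set_def)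
    then have "admissible (a # s) \<longleftrightarrow> admissible s \<and> card (crowded s) \<le> r a"
      using admissible_Cons_iff[of a s] below[of s a] by simp
    moreover have "a # s \<in> permutations_of_set A"
      using True by (auto simp: permutations_of_set_def)
    moreover have "largest (snd (overpartition_of s)) = card (crowded s)" if "admissible s"
      using overpartition_of_admissible \<open>distinct s\<close> that by blast
    ultimately show ?thesis using True by auto
  next
    case False
    then show ?thesis by (auto simp: permutations_of_set_def)
  qed
  \<comment> \<open>As \<open>Suc m\<close> is not 0, the two tests exclude each other and may be
    asked in the opposite order.\<close>
  have ov: "overpartition_of (a # s) = (let (D, L) = overpartition_of s in
      if r a = Suc m then (insert (Suc m) D, L) else if r a = 0 then (D, L) else (D, add_mset (r a) L))"
    if "a \<in> A" "s \<in> ?P (A - {a})" for a s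
    using step[OF that] below by (simp add: Let_def split: prod.split)
  show ?case
    unfolding bij_betw_def
  proof (intro conjI equalityI subsetI)
    show "inj_on overpartition_of (?P A)"
    proof (rule inj_onI)
      fix p p' assume p: "p \<in> ?P A" and p': "p' \<in> ?P A"
        and eq: "overpartition_of p = overpartition_of p'"
      have "A \<noteq> {}" using Suc.prems by auto
      with p p' obtain a s a' s' where s: "p = a # s" "p' = a' # s'"
        by (cases p; cases p') (auto simp: permutations_of_set_def)
      have a: "a \<in> A" "s \<in> ?P (A - {a})" "largest (snd (overpartition_of s)) \<le> r a"
        and a': "a' \<in> A" "s' \<in> ?P (A - {a'})" "largest (snd (overpartition_of s')) \<le> r a'"
        using p p' Cons s by simp_all
      obtain D L D' L' where DL: "overpartition_of s = (D, L)" "overpartition_of s' = (D', L')"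
        by fastforce
      have "fits m (D, L)" "fits m (D', L')"
        using step[OF a(1,2)] step[OF a'(1,2)] DL by simp_all
      then have no: "Suc m \<notin> D" "Suc m \<notin> D'" "0 \<notin># L" "0 \<notin># L'"
        by (auto simp: fits_def)
      have eq': "(if r a = Suc m then (insert (Suc m) D, L) else if r a = 0 then (D, L)
            else (D, add_mset (r a) L)) =
          (if r a' = Suc m then (insert (Suc m) D', L') else if r a' = 0 then (D', L')
            else (D', add_mset (r a') L'))"
        using eq ov[OF a(1,2)] ov[OF a'(1,2)] by (simp add: s DL)
      have zero: "r a = 0 \<Longrightarrow> L = {#}" "r a' = 0 \<Longrightarrow> L' = {#}"
        using a(3) a'(3) largest_in[of L] largest_in[of L'] no DL by fastforce+
      \<comment> \<open>The pair reveals the rank: it is \<open>Suc m\<close> if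
        \<open>Suc m\<close> lies in the first component, and otherwise the largest part of the
        second, with 0 for the empty multiset.\<close>
      have "r a = r a'"
      proof (cases "r a = Suc m")
        case True
        with eq' no show ?thesis by (auto split: if_splits)
      next
        case False
        with eq' no have "r a' \<noteq> Suc m" by (auto split: if_splits)
        moreover have "largest (if r a = 0 then L else add_mset (r a) L) = r a"
          "largest (if r a' = 0 then L' else add_mset (r a') L') = r a'"
          using a(3) a'(3) DL by auto
        ultimately show ?thesis using eq' False
          by (metis (full_types) prod.inject)
      qed
      moreover from this have "a = a'"
        using r a(1) a'(1) by (auto simp: bij_betw_def inj_on_def)
      moreover have "overpartition_of s = overpartition_of s'"
        using eq' no \<open>r a = r a'\<close> by (auto simp: DL insert_ident split: if_splits)
      ultimately have "s = s'"
        using IH[OF a(1)] a(2) a'(2) by (auto simp: bij_betw_def inj_on_def)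
      with \<open>a = a'\<close> s show "p = p'" by simp
    qed
  next
    fix q assume "q \<in> overpartition_of ` ?P A"
    then obtain p where p: "p \<in> ?P A" "q = overpartition_of p" by blast
    then have "length p = Suc (Suc m)"
      using Suc.prems(2) distinct_card[of p] by (simp add: permutations_of_set_def)
    then show "q \<in> {q. fits (Suc m) q}"
      using p overpartition_of_admissible[of p] by (simp add: permutations_of_set_def)
  next
    fix q assume "q \<in> {q. fits (Suc m) q}"
    moreover obtain D L where q: "q = (D, L)" by (cases q)
    ultimately have fit: "fits (Suc m) (D, L)" by simp
    then have L: "0 \<notin># L" by (simp add: fits_def)
    \<comment> \<open>Undo the last step: delete \<open>Suc m\<close> from \<open>D\<close> if it is
      there, otherwise delete one largest part of \<open>L\<close>, if any.\<close>
    have "\<exists>u q'. u \<le> Suc m \<and> fits m q' \<and> largest (snd q') \<le> u \<and>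
        q = (let (D, L) = q' in if u = Suc m then (insert (Suc m) D, L)
          else if u = 0 then (D, L) else (D, add_mset u L))"
    proof (cases "Suc m \<in> D")
      case True
      have "fits m (D - {Suc m}, L)"
        using fit fits_insert[of m "D - {Suc m}" L] True by (simp add: insert_absorb)
      moreover have "largest L \<le> Suc m" using fits_largest_le[OF fit] by simp
      ultimately show ?thesis using True q
        by (intro exI[of _ "Suc m"] exI[of _ "(D - {Suc m}, L)"]) auto
    next
      case False
      have "D \<subseteq> {1..m}"
      proof
        fix d assume "d \<in> D"
        with fit False show "d \<in> {1..m}" by (cases "d = Suc m") (auto simp: fits_def subset_iff)
      qed
      with fit L have *: "fits m (D, L - {#largest L#})" "largest L \<le> m"
        using fits_Suc by blast+
      have "largest (L - {#largest L#}) \<le> largest L"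
        using largest_le_iff by (metis in_diffD order_refl)
      moreover have "largest L \<noteq> 0 \<longleftrightarrow> L \<noteq> {#}" using largest_in[OF _ L] by force
      moreover have "add_mset (largest L) (L - {#largest L#}) = L" if "L \<noteq> {#}"
        using largest_in[OF that L] by simp
      ultimately show ?thesis using q *
        by (intro exI[of _ "largest L"] exI[of _ "(D, L - {#largest L#})"]) auto
    qed
    then obtain u q' where u: "u \<le> Suc m" and q': "fits m q'" "largest (snd q') \<le> u"
      and qq': "q = (let (D, L) = q' in if u = Suc m then (insert (Suc m) D, L)
          else if u = 0 then (D, L) else (D, add_mset u L))"
      by blast
    from r u obtain a where a: "a \<in> A" "r a = u"
      unfolding bij_betw_def by (metis imageE le_imp_less_Suc lessThan_iff)
    obtain s where s: "s \<in> ?P (A - {a})" "overpartition_of s = q'"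
      using IH[OF a(1)] q'(1) unfolding bij_betw_def by (metis (no_types, lifting) imageE mem_Collect_eq)
    have "a # s \<in> ?P A" using Cons a s q'(2) by simp
    moreover have "overpartition_of (a # s) = q"
      unfolding ov[OF a(1) s(1)] s(2) a(2) qq' ..
    ultimately show "q \<in> overpartition_of ` ?P A" by blast
  qed
qed

lemma av_eq_card_fits:
  "av (Suc m) k {[1, 3, 2, 4], [1, 3, 4, 2]} = card {q. fits m q \<and> weight q = k}"
proof -
  let ?P = "{p \<in> permutations_of_set {1..Suc m}. admissible p}"
  have bij: "bij_betw overpartition_of ?P {q. fits m q}"
    by (rule bij_betw_overpartition_of) auto
  have weight: "weight (overpartition_of p) = card (inversions p)" if "p \<in> ?P" for p
    using that overpartition_of_admissible[of p] by (auto simp: permutations_of_set_def)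
  have "overpartition_of ` {p \<in> ?P. card (inversions p) = k} = {q. fits m q \<and> weight q = k}"
  proof -
    have "overpartition_of ` {p \<in> ?P. card (inversions p) = k} =
        overpartition_of ` {p \<in> ?P. weight (overpartition_of p) = k}"
      using weight by (metis (no_types, lifting))
    also have "\<dots> = {q \<in> overpartition_of ` ?P. weight q = k}" by blast
    also have "\<dots> = {q. fits m q \<and> weight q = k}" using bij by (simp add: bij_betw_def)
    finally show ?thesis .
  qed
  moreover have "inj_on overpartition_of {p \<in> ?P. card (inversions p) = k}"
    using bij by (auto simp: bij_betw_def inj_on_def)
  then have "card (overpartition_of ` {p \<in> ?P. card (inversions p) = k}) =
      card {p \<in> ?P. card (inversions p) = k}"
    by (rule card_image)
  ultimately have "card {p \<in> ?P. card (inversions p) = k} = card {q. fits m q \<and> weight q = k}"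
    by simp
  then show ?thesis
    by (simp add: av_def admissible_def conj_ac)
qed

section \<open>The generating function of overpartitions\<close>

text \<open>The set \<open>D\<close> holds the overlined parts and \<open>L\<close> the others.
  Finiteness is demanded because an infinite set has sum 0 by convention.\<close>

definition overpartitions :: "nat \<Rightarrow> (nat set \<times> nat multiset) set" where
  "overpartitions k = {(D, L). finite D \<and> 0 \<notin> D \<and> 0 \<notin># L \<and> weight (D, L) = k}"

text \<open>The two bounds are separate so that numerators and denominators of the product can be
  introduced one at a time.\<close>

definition bounded_overpartitions :: "nat \<Rightarrow> nat \<Rightarrow> nat \<Rightarrow> (nat set \<times> nat multiset) set" where
  "bounded_overpartitions a b k =
     {(D, L). D \<subseteq> {1..a} \<and> set_mset L \<subseteq> {1..b} \<and> weight (D, L) = k}"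

lemma part_le_weight:
  assumes "finite D"
  shows "d \<in> D \<Longrightarrow> d \<le> weight (D, L)" and "x \<in># L \<Longrightarrow> x \<le> weight (D, L)"
  using member_le_sum[of d D "\<lambda>x. x"] assms
  by (auto simp: weight_def dest!: multi_member_split)

text \<open>No part exceeds the total weight, so bounds of at least \<open>k\<close> exclude
  nothing.\<close>

lemma bounded_overpartitions_eq:
  assumes "k \<le> a" "k \<le> b"
  shows "bounded_overpartitions a b k = overpartitions k"
proof -
  have "D \<subseteq> {1..a} \<and> set_mset L \<subseteq> {1..b} \<longleftrightarrow> finite D \<and> 0 \<notin> D \<and> 0 \<notin># L"
    if w: "weight (D, L) = k" for D L
  proof
    assume "D \<subseteq> {1..a} \<and> set_mset L \<subseteq> {1..b}"
    then show "finite D \<and> 0 \<notin> D \<and> 0 \<notin># L"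
      using finite_subset[of D "{1..a}"] by auto
  next
    assume *: "finite D \<and> 0 \<notin> D \<and> 0 \<notin># L"
    have "d \<in> {1..a}" if "d \<in> D" for d
    proof -
      have "d \<noteq> 0" using * that by metis
      with part_le_weight(1)[of D d L] * that w assms show ?thesis by simp
    qed
    moreover have "x \<in> {1..b}" if "x \<in># L" for x
    proof -
      have "x \<noteq> 0" using * that by metis
      with part_le_weight(2)[of D x L] * that w assms show ?thesis by simp
    qed
    ultimately show "D \<subseteq> {1..a} \<and> set_mset L \<subseteq> {1..b}" by blast
  qed
  then show ?thesis
    unfolding bounded_overpartitions_def overpartitions_def by blast
qed

lemma bounded_overpartitions_0:
  "bounded_overpartitions 0 0 k = (if k = 0 then {({}, {#})} else {})"
  by (auto simp: bounded_overpartitions_def weight_def)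

lemma bounded_overpartitions_Suc_left:
  "bounded_overpartitions (Suc a) b k = bounded_overpartitions a b k \<union>
     (if Suc a \<le> k then (\<lambda>(D, L). (insert (Suc a) D, L)) ` bounded_overpartitions a b (k - Suc a) else {})"
  (is "?l = ?r")
proof (intro equalityI subsetI)
  fix q assume "q \<in> ?l"
  then obtain D L where q: "q = (D, L)" and D: "D \<subseteq> {1..Suc a}" and L: "set_mset L \<subseteq> {1..b}"
    and w: "weight (D, L) = k"
    by (auto simp: bounded_overpartitions_def)
  show "q \<in> ?r"
  proof (cases "Suc a \<in> D")
    case True
    have "finite D" using D finite_subset by blast
    then have "\<Sum>D = Suc a + \<Sum>(D - {Suc a})" using True by (simp add: sum.remove)
    then have "(D - {Suc a}, L) \<in> bounded_overpartitions a b (k - Suc a)" "Suc a \<le> k"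
      using D L w by (auto simp: bounded_overpartitions_def weight_def le_Suc_eq)
    moreover have "q = (\<lambda>(D, L). (insert (Suc a) D, L)) (D - {Suc a}, L)"
      using True q by (simp add: insert_absorb)
    ultimately show ?thesis by (metis (lifting) UnI2 image_eqI)
  next
    case False
    with D have "D \<subseteq> {1..a}" by (auto simp: subset_iff le_Suc_eq)
    with L w q show ?thesis by (simp add: bounded_overpartitions_def)
  qed
next
  fix q assume "q \<in> ?r"
  then consider "q \<in> bounded_overpartitions a b k"
    | D L where "Suc a \<le> k" "q = (insert (Suc a) D, L)" "(D, L) \<in> bounded_overpartitions a b (k - Suc a)"
    by (auto split: if_splits)
  then show "q \<in> ?l"
  proof cases
    case 1
    then show ?thesis by (auto simp: bounded_overpartitions_def)
  next
    case 2
    then have "D \<subseteq> {1..a}" by (simp add: bounded_overpartitions_def)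
    then have "finite D" "Suc a \<notin> D" using finite_subset by auto
    with 2 show ?thesis by (auto simp: bounded_overpartitions_def weight_def)
  qed
qed

text \<open>Only one copy of \<open>Suc b\<close> is split off and more may remain, so the remainder
  keeps the bound \<open>Suc b\<close>. This is what produces a geometric series.\<close>

lemma bounded_overpartitions_Suc_right:
  "bounded_overpartitions a (Suc b) k = bounded_overpartitions a b k \<union>
     (if Suc b \<le> k then (\<lambda>(D, L). (D, add_mset (Suc b) L)) ` bounded_overpartitions a (Suc b) (k - Suc b) else {})"
  (is "?l = ?r")
proof (intro equalityI subsetI)
  fix q assume "q \<in> ?l"
  then obtain D L where q: "q = (D, L)" and D: "D \<subseteq> {1..a}" and L: "set_mset L \<subseteq> {1..Suc b}"
    and w: "weight (D, L) = k"
    by (auto simp: bounded_overpartitions_def)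
  show "q \<in> ?r"
  proof (cases "Suc b \<in># L")
    case True
    then obtain L' where L': "L = add_mset (Suc b) L'" by (metis multi_member_split)
    then have "(D, L') \<in> bounded_overpartitions a (Suc b) (k - Suc b)" "Suc b \<le> k"
      using D L w by (auto simp: bounded_overpartitions_def weight_def)
    moreover have "q = (\<lambda>(D, L). (D, add_mset (Suc b) L)) (D, L')"
      using L' q by simp
    ultimately show ?thesis by (metis (lifting) UnI2 image_eqI)
  next
    case False
    with L have "set_mset L \<subseteq> {1..b}" by (auto simp: subset_iff le_Suc_eq)
    with D w q show ?thesis by (simp add: bounded_overpartitions_def)
  qed
qed (auto simp: bounded_overpartitions_def weight_def split: if_splits)

lemma finite_bounded_overpartitions [simp]: "finite (bounded_overpartitions a b k)"
proof (induction a arbitrary: k)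
  case 0
  show ?case
  proof (induction b arbitrary: k)
    case 0
    show ?case by (simp add: bounded_overpartitions_0)
  next
    case (Suc b)
    show ?case
    proof (induction k rule: less_induct)
      case (less k)
      \<comment> \<open>The remainder keeps its bound but has smaller weight, hence the inner
        induction on \<open>k\<close>.\<close>
      then have "finite (bounded_overpartitions 0 (Suc b) (k - Suc b))" if "Suc b \<le> k"
        using that by simp
      with Suc show ?case by (subst bounded_overpartitions_Suc_right) auto
    qed
  qed
next
  case (Suc a)
  then show ?case by (simp add: bounded_overpartitions_Suc_left)
qed

lemma finite_overpartitions [simp]: "finite (overpartitions k)"
  using bounded_overpartitions_eq[of k k k] finite_bounded_overpartitions[of k k k] by simp

lemma card_bounded_overpartitions_Suc_left:
  "card (bounded_overpartitions (Suc a) b k) = card (bounded_overpartitions a b k) +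
     (if Suc a \<le> k then card (bounded_overpartitions a b (k - Suc a)) else 0)"
proof -
  let ?f = "\<lambda>(D, L). (insert (Suc a) D, L)"
  have no: "Suc a \<notin> D" if "(D, L) \<in> bounded_overpartitions a b j" for D L j
    using that by (auto simp: bounded_overpartitions_def)
  have "inj_on ?f (bounded_overpartitions a b (k - Suc a))"
    using no by (auto intro!: inj_onI simp: insert_ident)
  moreover have "bounded_overpartitions a b k \<inter> ?f ` bounded_overpartitions a b (k - Suc a) = {}"
    using no by fastforce
  ultimately show ?thesis
    by (simp add: bounded_overpartitions_Suc_left card_Un_disjoint card_image)
qed

lemma card_bounded_overpartitions_Suc_right:
  "card (bounded_overpartitions a (Suc b) k) = card (bounded_overpartitions a b k) +
     (if Suc b \<le> k then card (bounded_overpartitions a (Suc b) (k - Suc b)) else 0)"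
proof -
  let ?f = "\<lambda>(D, L). (D, add_mset (Suc b) L)"
  have no: "Suc b \<notin># L" if "(D, L) \<in> bounded_overpartitions a b j" for D L j
    using that by (auto simp: bounded_overpartitions_def)
  have "inj_on ?f (bounded_overpartitions a (Suc b) (k - Suc b))"
    by (auto intro!: inj_onI)
  moreover have "bounded_overpartitions a b k \<inter> ?f ` bounded_overpartitions a (Suc b) (k - Suc b) = {}"
    using no by fastforce
  ultimately show ?thesis
    by (subst bounded_overpartitions_Suc_right) (simp add: card_Un_disjoint card_image)
qed

section \<open>Generating functions and convergence of the infinite product\<close>

definition bounded_gf :: "nat \<Rightarrow> nat \<Rightarrow> rat fps" where
  "bounded_gf a b = Abs_fps (\<lambda>k. of_nat (card (bounded_overpartitions a b k)))"

definition overpartition_gf :: "rat fps" where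
  "overpartition_gf = Abs_fps (\<lambda>k. of_nat (card (overpartitions k)))"

lemma bounded_gf_Suc_left: "bounded_gf (Suc a) b = bounded_gf a b * (1 + fps_X ^ Suc a)"
  by (rule fps_ext)
     (simp add: bounded_gf_def card_bounded_overpartitions_Suc_left distrib_left
        fps_X_power_mult_right_nth del: power_Suc)

lemma bounded_gf_Suc_right: "bounded_gf a (Suc b) = bounded_gf a b / (1 - fps_X ^ Suc b)"
proof -
  have "bounded_gf a (Suc b) * (1 - fps_X ^ Suc b) = bounded_gf a b"
    by (rule fps_ext)
       (simp add: bounded_gf_def card_bounded_overpartitions_Suc_right[of a b] right_diff_distrib
          fps_X_power_mult_right_nth del: power_Suc)
  moreover have "(1 - fps_X ^ Suc b :: rat fps) \<noteq> 0"
    by (auto simp: fps_eq_iff intro!: exI[of _ 0])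
  ultimately show ?thesis
    by (metis nonzero_mult_div_cancel_right)
qed

text \<open>Factor \<open>i\<close> governs the parts of size \<open>Suc i\<close>, so the factors
  below \<open>n\<close> cover exactly the sizes 1 to \<open>n\<close>.\<close>

lemma prod_overpartition_factor: "(\<Prod>i<n. overpartition_factor i) = bounded_gf n n"
proof (induction n)
  case 0
  show ?case
    by (rule fps_ext) (simp add: bounded_gf_def bounded_overpartitions_0)
next
  case (Suc n)
  have "fps_nth (1 - fps_X ^ Suc n :: rat fps) 0 \<noteq> 0" by simp
  then show ?case
    using Suc
    by (simp add: bounded_gf_Suc_right bounded_gf_Suc_left overpartition_factor_def
        fps_divide_unit mult_ac del: power_Suc)
qed

lemma has_prod_overpartition_factor: "overpartition_factor has_prod overpartition_gf"
proof -
  have "(\<lambda>n. \<Prod>i\<le>n. overpartition_factor i) \<longlonglongrightarrow> overpartition_gf"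
  proof (rule tendsto_fpsI)
    fix k
    show "\<forall>\<^sub>F n in sequentially. fps_nth (\<Prod>i\<le>n. overpartition_factor i) k = fps_nth overpartition_gf k"
      using eventually_ge_at_top[of k]
      by eventually_elim
         (simp add: lessThan_Suc_atMost[symmetric] prod_overpartition_factor bounded_gf_def
            overpartition_gf_def bounded_overpartitions_eq del: prod.lessThan_Suc)
  qed
  \<comment> \<open>A limit in the sense of \<open>raw_has_prod\<close> must be nonzero; the empty
    overpartition gives constant coefficient 1.\<close>
  moreover have "overpartitions 0 = {({}, {#})}"
    using bounded_overpartitions_eq[of 0 0 0] bounded_overpartitions_0[of 0] by simp
  then have "fps_nth overpartition_gf 0 \<noteq> 0"
    by (simp add: overpartition_gf_def)
  then have "overpartition_gf \<noteq> 0" by auto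
  ultimately show ?thesis by (simp add: has_prod_def raw_has_prod_def)
qed

section \<open>Overpartitions that do not fit\<close>

lemma filter_mset_ident: "(\<And>x. x \<in># M \<Longrightarrow> P x) \<Longrightarrow> filter_mset P M = M"
  by (induction M) auto

definition tail_size :: "nat \<Rightarrow> nat set \<times> nat multiset \<Rightarrow> nat" where
  "tail_size v q = size (filter_mset ((\<le>) v) (snd q)) + card {d \<in> fst q. v < d}"

text \<open>A part counted in the tail at \<open>v\<close> has size at least \<open>v\<close> and is
  charged \<open>1 + (v - 1)\<close>; any other part is charged at most 1.\<close>

lemma tail_size_weight:
  assumes "finite D" "1 \<le> v"
  shows "tail_size 1 (D, L) + (v - 1) * tail_size v (D, L) \<le> weight (D, L)"
proof -
  have "size (filter_mset ((\<le>) 1) L) + (v - 1) * size (filter_mset ((\<le>) v) L) \<le> sum_mset L"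
    by (induction L) auto
  moreover have "card {d \<in> D. 1 < d} + (v - 1) * card {d \<in> D. v < d} \<le> \<Sum>D"
    using assms(1)
  proof induction
    case (insert x F)
    have "{d \<in> insert x F. u < d} = (if u < x then insert x {d \<in> F. u < d} else {d \<in> F. u < d})" for u
      by auto
    with insert assms(2) show ?case by auto
  qed simp
  ultimately show ?thesis
    by (simp add: tail_size_def weight_def distrib_left)
qed

lemma tail_size_antimono:
  assumes "finite D" "u \<le> v"
  shows "tail_size v (D, L) \<le> tail_size u (D, L)"
proof -
  have "size (filter_mset ((\<le>) v) L) \<le> size (filter_mset ((\<le>) u) L)"
    using assms(2) by (induction L) auto
  moreover have "card {d \<in> D. v < d} \<le> card {d \<in> D. u < d}"
    using assms by (intro card_mono) auto
  ultimately show ?thesis by (simp add: tail_size_def)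
qed

lemma tail_size_eq_0_iff:
  assumes "finite D"
  shows "tail_size v (D, L) = 0 \<longleftrightarrow> (\<forall>x \<in># L. x < v) \<and> (\<forall>d \<in> D. d \<le> v)"
  using assms by (auto simp: tail_size_def not_le not_less)

text \<open>The conditions for \<open>v > m\<close> follow from the one at \<open>m\<close>, and a
  failure strictly between 1 and \<open>m\<close> needs weight at least \<open>2 * (m - 1)\<close>,
  which exceeds \<open>k\<close>.\<close>

lemma not_fits_iff:
  assumes q: "q \<in> overpartitions k" and k: "k + 3 \<le> 2 * m"
  shows "\<not> fits m q \<longleftrightarrow> 0 < tail_size m q \<or> m \<le> tail_size 1 q"
    and "\<not> (0 < tail_size m q \<and> m \<le> tail_size 1 q)"
proof -
  obtain D L where DL: "q = (D, L)" and D: "finite D" "0 \<notin> D" and L: "0 \<notin># L"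
    and w: "weight (D, L) = k"
    using q by (auto simp: overpartitions_def)
  have m: "2 \<le> m" using k by linarith
  have D': "\<forall>d \<in> D. 1 \<le> d" using D(2) by (metis One_nat_def Suc_leI gr0I)
  have fits: "fits m q \<longleftrightarrow> D \<subseteq> {1..m} \<and> (\<forall>v \<ge> 1. tail_size v q \<le> m - v)"
    using L by (simp add: fits_def tail_size_def DL)
  \<comment> \<open>A failure at v costs weight \<open>v (m - v + 1) = 2 (m - 1) + (v - 2) (m - 1 - v)\<close>.\<close>
  have mid: "tail_size v q \<le> m - v" if v: "2 \<le> v" "v < m" for v
  proof (rule ccontr)
    assume "\<not> tail_size v q \<le> m - v"
    then have "m - v + 1 \<le> tail_size v q" by simp
    then have "v * (m - v + 1) \<le> v * tail_size v q" by (rule mult_le_mono2)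
    also have "\<dots> = tail_size v q + (v - 1) * tail_size v q"
      using v by (cases v) auto
    also have "\<dots> \<le> tail_size 1 q + (v - 1) * tail_size v q"
      using tail_size_antimono[OF D(1), of 1 v L] v by (simp add: DL)
    also have "\<dots> \<le> k"
      using tail_size_weight[OF D(1), of v L] v w by (simp add: DL)
    finally have "v * (m - v + 1) \<le> k" .
    moreover have "2 * (m - 1) \<le> v * (m - v + 1)"
    proof -
      \<comment> \<open>This removes the truncated subtractions; the two sides then differ by
        \<open>a * b\<close>.\<close>
      obtain a b where "v = a + 2" "m = a + 2 + b + 1"
        using v by (metis add.commute add.assoc le_Suc_ex less_iff_Suc_add Suc_eq_plus1)
      then show ?thesis by (simp add: algebra_simps)
    qed
    ultimately show False using k by linarith
  qed
  show "\<not> fits m q \<longleftrightarrow> 0 < tail_size m q \<or> m \<le> tail_size 1 q"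
  proof
    assume "\<not> fits m q"
    show "0 < tail_size m q \<or> m \<le> tail_size 1 q"
    proof (rule ccontr)
      assume "\<not> (0 < tail_size m q \<or> m \<le> tail_size 1 q)"
      then have 0: "tail_size m q = 0" and 1: "tail_size 1 q \<le> m - 1" by auto
      have "tail_size v q \<le> m - v" if "1 \<le> v" for v
      proof -
        consider "v = 1" | "2 \<le> v" "v < m" | "m \<le> v" using \<open>1 \<le> v\<close> by linarith
        then show ?thesis
        proof cases
          case 3
          then show ?thesis using tail_size_antimono[OF D(1), of m v L] 0 by (simp add: DL)
        qed (use 1 mid in auto)
      qed
      moreover have "D \<subseteq> {1..m}"
        using 0 D' tail_size_eq_0_iff[OF D(1)] by (auto simp: DL)
      ultimately show False using fits \<open>\<not> fits m q\<close> by blast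
    qed
  next
    assume "0 < tail_size m q \<or> m \<le> tail_size 1 q"
    then have "\<not> tail_size m q \<le> m - m \<or> \<not> tail_size 1 q \<le> m - 1" using m by auto
    then show "\<not> fits m q" using fits m by (meson le_refl one_le_numeral order_trans)
  qed
  show "\<not> (0 < tail_size m q \<and> m \<le> tail_size 1 q)"
  proof
    assume *: "0 < tail_size m q \<and> m \<le> tail_size 1 q"
    \<comment> \<open>Both failures together need weight at least
      \<open>m + (m - 1)\<close>.\<close>
    then have "(m - 1) * 1 \<le> (m - 1) * tail_size m q" by (intro mult_le_mono2) simp
    moreover have "tail_size 1 q + (m - 1) * tail_size m q \<le> k"
      using tail_size_weight[OF D(1), of m L] m w by (simp add: DL)
    ultimately show False
      using * m k by linarith
  qed
qed

text \<open>The pair \<open>(e, j)\<close> stands for the term of exponent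
  \<open>j + of_bool e\<close> in the expansion of \<open>x^m (1 + x) / (1 - x)\<close>, up to
  exponent \<open>k\<close>.\<close>

definition gap_pairs :: "nat \<Rightarrow> nat \<Rightarrow> (bool \<times> nat) set" where
  "gap_pairs m k = {(e, j). m \<le> j \<and> j + of_bool e \<le> k}"

text \<open>The common model of the two failures: an overpartition of the weight left by a part or column of size j.\<close>

definition pointed :: "nat \<Rightarrow> nat \<Rightarrow> ((bool \<times> nat) \<times> nat set \<times> nat multiset) set" where
  "pointed m k = (SIGMA (e, j):gap_pairs m k. overpartitions (k - of_bool e - j))"

text \<open>The tail at \<open>m\<close> counts parts of \<open>L\<close> from \<open>m\<close> on,
  but parts of \<open>D\<close> only from \<open>m + 1\<close> on; hence \<open>Suc j\<close> in
  \<open>D\<close> against \<open>j\<close> in \<open>L\<close>.\<close>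

definition add_part :: "(bool \<times> nat) \<times> nat set \<times> nat multiset \<Rightarrow> nat set \<times> nat multiset" where
  "add_part = (\<lambda>((e, j), D, L). if e then (insert (Suc j) D, L) else (D, add_mset j L))"

text \<open>
  Increases every part by one and adds parts equal to 1 to L until there are j parts, plus the
  part 1 in D if e holds. The truncated difference is harmless as long as \<open>card D + size L \<le> j\<close>.
\<close>

definition add_column :: "(bool \<times> nat) \<times> nat set \<times> nat multiset \<Rightarrow> nat set \<times> nat multiset" where
  "add_column = (\<lambda>((e, j), D, L). (Suc ` D \<union> (if e then {1} else {}),
     image_mset Suc L + replicate_mset (j - (card D + size L)) 1))"

lemma pointedD:
  assumes "((e, j), D, L) \<in> pointed m k"
  shows "m \<le> j" "j + of_bool e \<le> k" "finite D" "0 \<notin> D" "0 \<notin># L"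
    "weight (D, L) + j + of_bool e = k"
  using assms by (auto simp: pointed_def gap_pairs_def overpartitions_def)

lemma pointedI:
  assumes "m \<le> j" "finite D" "0 \<notin> D" "0 \<notin># L" "weight (D, L) + j + of_bool e = k"
  shows "((e, j), D, L) \<in> pointed m k"
  using assms by (auto simp: pointed_def gap_pairs_def overpartitions_def)

text \<open>After a part of size at least \<open>m\<close> is removed, the remaining weight is below
  \<open>m\<close>. So the large part is unique and can be recovered.\<close>

lemma bij_betw_add_part:
  assumes "k < 2 * m"
  shows "bij_betw add_part (pointed m k) {q \<in> overpartitions k. 0 < tail_size m q}"
proof -
  have small: "(\<forall>d \<in> D. d < m) \<and> (\<forall>x \<in># L. x < m)" if "((e, j), D, L) \<in> pointed m k" for e j D L
    using pointedD[OF that] part_le_weight[of D _ L] assms by fastforce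
  have inj: "inj_on add_part (pointed m k)"
  proof (rule inj_onI)
    fix t t' assume t: "t \<in> pointed m k" and t': "t' \<in> pointed m k" and eq: "add_part t = add_part t'"
    obtain e j D L e' j' D' L' where tt: "t = ((e, j), D, L)" "t' = ((e', j'), D', L')"
      by (metis prod.exhaust)
    note s = small[OF t[unfolded tt]] small[OF t'[unfolded tt]]
    note j = pointedD(1)[OF t[unfolded tt]] pointedD(1)[OF t'[unfolded tt]]
    have no: "Suc j \<notin> D" "Suc j' \<notin> D" "Suc j \<notin> D'" "Suc j' \<notin> D'"
      "j \<notin># L" "j' \<notin># L" "j \<notin># L'" "j' \<notin># L'"
      using s j by fastforce+
    show "t = t'"
    proof (cases e; cases e')
      assume e: "e" "e'"
      with eq have *: "insert (Suc j) D = insert (Suc j') D'" "L = L'"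
        by (simp_all add: tt add_part_def)
      then have "j = j'" using no by (metis insertE insertI1 nat.inject)
      with * no e show ?thesis by (simp add: tt insert_ident)
    next
      assume e: "e" "\<not> e'"
      with eq have "L = add_mset j' L'" by (simp add: tt add_part_def)
      with no show ?thesis by simp
    next
      assume e: "\<not> e" "e'"
      with eq have "L' = add_mset j L" by (simp add: tt add_part_def)
      with no show ?thesis by simp
    next
      assume e: "\<not> e" "\<not> e'"
      with eq have *: "add_mset j L = add_mset j' L'" "D = D'"
        by (simp_all add: tt add_part_def)
      then have "j = j'" using no by (metis union_single_eq_member insert_noteq_member)
      with * e show ?thesis by (simp add: tt)
    qed
  qed
  have "add_part ` pointed m k = {q \<in> overpartitions k. 0 < tail_size m q}"
  proof (intro equalityI subsetI)
    fix q assume "q \<in> add_part ` pointed m k"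
    then obtain e j D L where t: "((e, j), D, L) \<in> pointed m k" and q: "q = add_part ((e, j), D, L)"
      by (metis imageE prod.exhaust)
    note p = pointedD[OF t]
    have "Suc j \<notin> D" "0 < j" using small[OF t] p(1) assms by fastforce+
    then have "q \<in> overpartitions k"
      using p by (auto simp: q add_part_def overpartitions_def weight_def)
    moreover have "tail_size m q \<noteq> 0"
      using p by (cases e) (simp_all add: q add_part_def tail_size_eq_0_iff del: neq0_conv)
    ultimately show "q \<in> {q \<in> overpartitions k. 0 < tail_size m q}" by simp
  next
    fix q assume q: "q \<in> {q \<in> overpartitions k. 0 < tail_size m q}"
    then obtain D L where DL: "q = (D, L)" and D: "finite D" "0 \<notin> D" and L: "0 \<notin># L"
      and w: "weight (D, L) = k"
      by (auto simp: overpartitions_def)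
    from q tail_size_eq_0_iff[OF D(1), of m L]
    consider x where "x \<in># L" "m \<le> x" | d where "d \<in> D" "m < d"
      by (auto simp: DL not_less not_le)
    then show "q \<in> add_part ` pointed m k"
    proof cases
      case 1
      have "((False, x), D, L - {#x#}) \<in> pointed m k"
        using 1 D L w by (intro pointedI) (auto simp: weight_def dest: in_diffD multi_member_split)
      moreover have "add_part ((False, x), D, L - {#x#}) = q"
        using 1 by (simp add: add_part_def DL)
      ultimately show ?thesis by (metis imageI)
    next
      case 2
      then have "((True, d - 1), D - {d}, L) \<in> pointed m k"
        using D L w by (intro pointedI) (auto simp: weight_def sum.remove)
      moreover have "add_part ((True, d - 1), D - {d}, L) = q"
        using 2 by (simp add: add_part_def DL insert_absorb)
      ultimately show ?thesis by (metis imageI)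
    qed
  qed
  with inj show ?thesis by (simp add: bij_betw_def)
qed

lemma size_le_weight:
  assumes "finite D" "0 \<notin> D" "0 \<notin># L"
  shows "card D + size L \<le> weight (D, L)"
proof -
  have "size L \<le> sum_mset L" using assms(3) by (induction L) auto
  moreover have "card D \<le> \<Sum>D" using assms(1,2) by induction auto
  ultimately show ?thesis by (simp add: weight_def)
qed

text \<open>Raising all parts adds \<open>card D + size L\<close>, and the new ones in
  \<open>L\<close> fill this up to \<open>j\<close>. A part 1 in \<open>D\<close> adds to the weight
  but is not counted by the tail at 1.\<close>

lemma weight_add_column:
  assumes "finite D" "0 \<notin> D" "card D + size L \<le> j"
  shows "weight (add_column ((e, j), D, L)) = weight (D, L) + j + of_bool e"
    and "tail_size 1 (add_column ((e, j), D, L)) = j"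
proof -
  have "\<Sum>(Suc ` D) = \<Sum>D + card D"
    by (simp add: sum.reindex sum.distrib sum_Suc)
  moreover have "1 \<notin> Suc ` D" using assms(2) by auto
  moreover have "sum_mset (image_mset Suc L) = sum_mset L + size L"
    by (induction L) auto
  ultimately show "weight (add_column ((e, j), D, L)) = weight (D, L) + j + of_bool e"
    using assms by (simp add: add_column_def weight_def)
  have "{d \<in> Suc ` D \<union> (if e then {1} else {}). 1 < d} = Suc ` D"
    using assms(2) by (auto intro: gr0I)
  moreover have "filter_mset ((\<le>) 1) (image_mset Suc L + replicate_mset n 1) =
      image_mset Suc L + replicate_mset n 1" for n
    by (rule filter_mset_ident) (auto split: if_splits)
  ultimately show "tail_size 1 (add_column ((e, j), D, L)) = j"
    using assms(3) by (simp add: tail_size_def add_column_def card_image)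
qed

text \<open>The remaining weight is below \<open>m \<le> j\<close>, so there are at most
  \<open>j\<close> parts to raise. From the image, \<open>j\<close> is the tail at 1,
  \<open>e\<close> tells whether 1 lies in \<open>D\<close>, and the parts above 1 are the raised
  ones.\<close>

lemma bij_betw_add_column:
  assumes "k < 2 * m"
  shows "bij_betw add_column (pointed m k) {q \<in> overpartitions k. m \<le> tail_size 1 q}"
proof -
  have room: "card D + size L \<le> j" if "((e, j), D, L) \<in> pointed m k" for e j D L
    using pointedD[OF that] size_le_weight[of D L] assms by simp
  have inj: "inj_on add_column (pointed m k)"
  proof (rule inj_onI)
    fix t t' assume t: "t \<in> pointed m k" and t': "t' \<in> pointed m k" and eq: "add_column t = add_column t'"
    obtain e j D L e' j' D' L' where tt: "t = ((e, j), D, L)" "t' = ((e', j'), D', L')"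
      by (metis prod.exhaust)
    note p = pointedD[OF t[unfolded tt]] and p' = pointedD[OF t'[unfolded tt]]
    have "j = j'"
      using weight_add_column(2)[of D L j e] weight_add_column(2)[of D' L' j' e'] p p'
        room t t' eq tt by metis
    from eq have D: "Suc ` D \<union> (if e then {1} else {}) = Suc ` D' \<union> (if e' then {1} else {})"
      and L: "image_mset Suc L + replicate_mset (j - (card D + size L)) 1 =
        image_mset Suc L' + replicate_mset (j' - (card D' + size L')) 1"
      by (simp_all add: tt add_column_def)
    have one: "1 \<notin> Suc ` D" "1 \<notin> Suc ` D'" using p(4) p'(4) by auto
    then have e: "e \<longleftrightarrow> e'" using D by (auto split: if_splits)
    have "Suc ` D = Suc ` D'"
      using D one e by (cases e) (simp_all add: insert_ident)
    then have "D = D'" by (simp add: inj_image_eq_iff)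
    have "filter_mset ((<) 1) (image_mset Suc L + replicate_mset n 1) = image_mset Suc L"
      if "0 \<notin># L" for L n
    proof -
      have "filter_mset ((<) 1) (image_mset Suc L) = image_mset Suc L"
        using that by (intro filter_mset_ident) (auto intro: gr0I)
      moreover have "filter_mset ((<) 1) (replicate_mset n (1 :: nat)) = {#}"
        by (auto split: if_splits)
      ultimately show ?thesis by (simp only: filter_union_mset add_0_right)
    qed
    then have "image_mset Suc L = image_mset Suc L'"
      using L p(5) p'(5) by metis
    then have "L = L'" using injD[OF multiset.inj_map[of Suc]] by simp
    with \<open>D = D'\<close> \<open>j = j'\<close> e show "t = t'" by (simp add: tt)
  qed
  have "add_column ` pointed m k = {q \<in> overpartitions k. m \<le> tail_size 1 q}"
  proof (intro equalityI subsetI)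
    fix q assume "q \<in> add_column ` pointed m k"
    then obtain e j D L where t: "((e, j), D, L) \<in> pointed m k" and q: "q = add_column ((e, j), D, L)"
      by (metis imageE prod.exhaust)
    note p = pointedD[OF t]
    have "weight q = k" "tail_size 1 q = j"
      using weight_add_column[of D L j e] p room[OF t] by (simp_all add: q)
    moreover from this have "q \<in> overpartitions k"
      using p by (auto simp: q add_column_def overpartitions_def)
    ultimately show "q \<in> {q \<in> overpartitions k. m \<le> tail_size 1 q}" using p(1) by simp
  next
    fix q assume q: "q \<in> {q \<in> overpartitions k. m \<le> tail_size 1 q}"
    then obtain D L where DL: "q = (D, L)" and D: "finite D" "0 \<notin> D" and L: "0 \<notin># L"
      and w: "weight (D, L) = k"
      by (auto simp: overpartitions_def)
    \<comment> \<open>Delete the first column: parts above 1 drop by one, parts 1 of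
      \<open>L\<close> vanish, and a part 1 of \<open>D\<close> is remembered by
      \<open>e\<close>.\<close>
    define D' where "D' = {d. Suc d \<in> D \<and> d \<noteq> 0}"
    define L' where "L' = image_mset (\<lambda>x. x - 1) (filter_mset (\<lambda>x. x \<noteq> 1) L)"
    have SucD: "Suc ` D' = {d \<in> D. 1 < d}"
    proof (intro equalityI subsetI)
      fix d assume "d \<in> {d \<in> D. 1 < d}"
      then have "d = Suc (d - 1)" "d - 1 \<in> D'" by (auto simp: D'_def)
      then show "d \<in> Suc ` D'" by (metis imageI)
    qed (auto simp: D'_def)
    have SucL: "image_mset Suc L' = filter_mset (\<lambda>x. x \<noteq> 1) L"
    proof -
      have "image_mset Suc L' = image_mset (\<lambda>x. Suc (x - 1)) (filter_mset (\<lambda>x. x \<noteq> 1) L)"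
        by (simp add: L'_def multiset.map_comp comp_def)
      also have "\<dots> = image_mset (\<lambda>x. x) (filter_mset (\<lambda>x. x \<noteq> 1) L)"
        using L by (intro image_mset_cong) (auto intro: Suc_pred gr0I)
      finally show ?thesis by simp
    qed
    define j where "j = tail_size 1 q"
    have L1: "L = image_mset Suc L' + replicate_mset (count L 1) 1"
      using multiset_partition[of L "\<lambda>x. x \<noteq> 1"] by (simp add: SucL filter_eq_replicate_mset)
    have "filter_mset ((\<le>) 1) L = L"
      using L by (intro filter_mset_ident) (auto simp: Suc_le_eq intro: gr0I)
    moreover have "card {d \<in> D. 1 < d} = card D'"
      unfolding SucD[symmetric] by (simp add: card_image)
    moreover have "size L = size L' + count L 1"
      using arg_cong[OF L1, of size] by simp
    ultimately have j: "j = card D' + size L' + count L 1"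
      by (simp add: j_def tail_size_def DL)
    have "1 < d" if "d \<in> D" "d \<noteq> 1" for d
      using D(2) that by (cases d) auto
    then have "D = {d \<in> D. 1 < d} \<union> (if 1 \<in> D then {1} else {})" by auto
    then have img: "add_column ((1 \<in> D, j), D', L') = q"
      using L1 by (simp add: add_column_def DL SucD j)
    have "finite (Suc ` D')" using D(1) SucD by simp
    then have fin: "finite D'" by (simp add: finite_image_iff)
    moreover have "0 \<notin> D'" unfolding D'_def by simp
    moreover have "0 \<notin># L'" using L by (auto simp: L'_def le_Suc_eq)
    moreover have "weight (D', L') + j + of_bool (1 \<in> D) = k"
      using weight_add_column(1)[of D' L' j "1 \<in> D"] fin \<open>0 \<notin> D'\<close> j w img DL by simp
    ultimately have "((1 \<in> D, j), D', L') \<in> pointed m k"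
      using q by (intro pointedI) (auto simp: j_def)
    with img show "q \<in> add_column ` pointed m k" by (metis imageI)
  qed
  with inj show ?thesis by (simp add: bij_betw_def)
qed

section \<open>The count and its generating function\<close>

lemma card_fits:
  assumes "k + 3 \<le> 2 * m"
  shows "card {q. fits m q \<and> weight q = k} + 2 * card (pointed m k) = card (overpartitions k)"
proof -
  let ?F = "{q. fits m q \<and> weight q = k}"
  let ?T = "{q \<in> overpartitions k. 0 < tail_size m q}"
  let ?W = "{q \<in> overpartitions k. m \<le> tail_size 1 q}"
  \<comment> \<open>The fitting pairs and the two kinds of failure are disjoint; each kind of
    failure is counted by \<open>pointed m k\<close>.\<close>
  have un: "overpartitions k = ?F \<union> (?T \<union> ?W)"
  proof -
    have 1: "q \<in> overpartitions k" if "fits m q" "weight q = k" for q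
      using that finite_subset[of "fst q" "{1..m}"]
      by (cases q) (auto simp: fits_def overpartitions_def)
    have 2: "weight q = k" if "q \<in> overpartitions k" for q
      using that by (auto simp: overpartitions_def)
    show ?thesis
    proof (intro equalityI subsetI)
      fix q assume q: "q \<in> overpartitions k"
      show "q \<in> ?F \<union> (?T \<union> ?W)"
      proof (cases "fits m q")
        case True
        with 2[OF q] show ?thesis by simp
      next
        case False
        with not_fits_iff(1)[OF q assms] q show ?thesis by simp
      qed
    next
      fix q assume "q \<in> ?F \<union> (?T \<union> ?W)"
      with 1[of q] show "q \<in> overpartitions k" by fast
    qed
  qed
  have less: "k < 2 * m" using assms by simp
  have "finite (?F \<union> (?T \<union> ?W))" by (simp only: un[symmetric] finite_overpartitions)
  then have fin: "finite ?F" "finite ?T" "finite ?W" by (simp_all only: finite_Un)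
  have "\<not> fits m q" if "q \<in> ?T \<union> ?W" for q
    using not_fits_iff(1)[of q, OF _ assms] that by auto
  then have "?F \<inter> (?T \<union> ?W) = {}" by fast
  with fin have "card (?F \<union> (?T \<union> ?W)) = card ?F + card (?T \<union> ?W)"
    by (intro card_Un_disjoint finite_UnI)
  with un have "card (overpartitions k) = card ?F + card (?T \<union> ?W)"
    by (rule ssubst[where P = "\<lambda>A. card A = _"])
  also have "?T \<inter> ?W = {}"
    using not_fits_iff(2)[OF _ assms] by fast
  then have "card (?T \<union> ?W) = card ?T + card ?W"
    using fin by (intro card_Un_disjoint)
  also have "card ?T = card (pointed m k)"
    using bij_betw_same_card[OF bij_betw_add_part[OF less]] ..
  also have "card ?W = card (pointed m k)"
    using bij_betw_same_card[OF bij_betw_add_column[OF less]] ..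
  finally show ?thesis by simp
qed

text \<open>Division by \<open>1 - fps_X\<close> forms partial sums of coefficients. The pairs with
  \<open>e\<close> false give the series \<open>F\<close>, and those with \<open>e\<close> true give
  \<open>F\<close> shifted by one.\<close>

lemma card_pointed_gf:
  "of_nat (card (pointed m k)) =
     fps_nth (fps_X ^ m * (1 + fps_X) / (1 - fps_X) * overpartition_gf) k"
proof -
  define F where "F = fps_X ^ m * (overpartition_gf / (1 - fps_X))"
  let ?c = "\<lambda>k. card (overpartitions k)"
  have F: "fps_nth F n = of_nat (\<Sum>j=m..n. ?c (n - j))" for n
  proof (cases "n < m")
    case False
    have "(\<Sum>j=m..n. ?c (n - j)) = (\<Sum>i=0..n - m. ?c i)"
      by (rule sum.reindex_bij_witness[of _ "\<lambda>i. n - i" "\<lambda>j. n - j"]) (use False in auto)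
    with False show ?thesis
      by (simp add: F_def fps_X_power_mult_nth fps_divide_fps_X_minus1_sum overpartition_gf_def)
  qed (simp add: F_def fps_X_power_mult_nth)
  have pairs: "gap_pairs m k = Pair False ` {m..k} \<union> Pair True ` {m..<k}"
    by (auto simp: gap_pairs_def image_iff)
  have "card (pointed m k) = (\<Sum>(e, j)\<in>gap_pairs m k. ?c (k - of_bool e - j))"
    by (simp add: pointed_def pairs case_prod_unfold)
  also have "\<dots> = (\<Sum>j=m..k. ?c (k - j)) + (\<Sum>j=m..<k. ?c (k - 1 - j))"
    unfolding pairs by (subst sum.union_disjoint) (auto simp: sum.reindex inj_on_def)
  finally have "of_nat (card (pointed m k)) = fps_nth (F + fps_X * F) k"
    by (cases k) (simp_all add: F atLeastLessThanSuc_atLeastAtMost)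
  also have "F + fps_X * F = fps_X ^ m * (1 + fps_X) / (1 - fps_X) * overpartition_gf"
    by (simp add: F_def fps_divide_unit algebra_simps)
  finally show ?thesis .
qed

lemma av_gf:
  assumes "real n \<ge> (real k + 7) / 2"
  shows "rat_of_nat (av n k {[1, 3, 2, 4], [1, 3, 4, 2]}) =
    fps_nth ((1 - fps_X - fps_X ^ (n - 1) * (2 + 2 * fps_X)) / (1 - fps_X) * overpartition_gf) k"
proof -
  obtain m where n: "n = Suc m" using assms by (cases n) auto
  have "k + 3 \<le> 2 * m" using assms by (simp add: n)
  then have "rat_of_nat (av n k {[1, 3, 2, 4], [1, 3, 4, 2]}) + 2 * rat_of_nat (card (pointed m k)) =
      rat_of_nat (card (overpartitions k))"
    unfolding n av_eq_card_fits using arg_cong[OF card_fits, of k m rat_of_nat] by simp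
  then have "rat_of_nat (av n k {[1, 3, 2, 4], [1, 3, 4, 2]}) =
      fps_nth overpartition_gf k - 2 * fps_nth (fps_X ^ m * (1 + fps_X) / (1 - fps_X) * overpartition_gf) k"
    by (simp add: card_pointed_gf overpartition_gf_def)
  also have "\<dots> = fps_nth (overpartition_gf -
      fps_const 2 * (fps_X ^ m * (1 + fps_X) / (1 - fps_X) * overpartition_gf)) k"
    by simp
  also have "overpartition_gf - fps_const 2 * (fps_X ^ m * (1 + fps_X) / (1 - fps_X) * overpartition_gf) =
      (1 - fps_X - fps_X ^ m * (2 + 2 * fps_X)) / (1 - fps_X) * overpartition_gf"
  proof -
    \<comment> \<open>This relation brings the first summand over the common denominator.\<close>
    have "inverse (1 - fps_X) * (1 - fps_X) = (1 :: rat fps)"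
      by (rule inverse_mult_eq_1) simp
    then show ?thesis
      by (simp add: fps_divide_unit numeral_fps_const[symmetric]) algebra
  qed
  finally show ?thesis by (simp add: n)
qed

text \<open>Here \<open>k < m\<close>, so no part or column of size at least \<open>m\<close> is
  available and both failures are impossible.\<close>

lemma av_eventually:
  assumes "k + 4 \<le> n"
  shows "av n k {[1, 3, 2, 4], [1, 3, 4, 2]} = card (overpartitions k)"
proof -
  obtain m where n: "n = Suc m" using assms by (cases n) auto
  have "pointed m k = {}" using assms by (auto simp: pointed_def gap_pairs_def n)
  then show ?thesis
    unfolding n av_eq_card_fits using card_fits[of k m] assms by (simp add: n)
qed

theorem theorem6p12:
  defines "B \<equiv> {[1, 3, 2, 4], [1, 3, 4, 2]}"
  shows "has_limit_gf B \<and>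
    convergent_prod overpartition_factor \<and>
    limit_gf B = (\<Prod>i. overpartition_factor i) \<and>
    (\<forall>(k::nat) (n::nat). real n \<ge> (real k + 7) / 2 \<longrightarrow>
       int (av (n + 1) k B) - int (av n k B) \<ge> 0 \<and>
       rat_of_int (int (av (n + 1) k B) - int (av n k B)) =
         fps_nth (fps_X ^ (n - 1) * (2 + 2 * fps_X) * limit_gf B) k \<and>
       rat_of_nat (av n k B) =
         fps_nth ((1 - fps_X - fps_X ^ (n - 1) * (2 + 2 * fps_X)) / (1 - fps_X)
                    * (\<Prod>i. overpartition_factor i)) k)"
proof -
  have prodinf: "(\<Prod>i. overpartition_factor i) = overpartition_gf"
    using has_prod_unique[OF has_prod_overpartition_factor] by simp
  have ev: "\<forall>n \<ge> k + 4. av n k B = card (overpartitions k)" for k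
    using av_eventually by (simp add: B_def)
  have "limit_coeff B k = card (overpartitions k)" for k
    unfolding limit_coeff_def
  proof (rule the_equality)
    show "\<exists>m. \<forall>n \<ge> m. av n k B = card (overpartitions k)" using ev by blast
  next
    fix c assume "\<exists>m. \<forall>n \<ge> m. av n k B = c"
    then obtain m where "\<forall>n \<ge> m. av n k B = c" by blast
    \<comment> \<open>Two eventual values agree at the larger of the two thresholds.\<close>
    with ev[of k] show "c = card (overpartitions k)" by (metis max.cobounded1 max.cobounded2)
  qed
  then have limit: "limit_gf B = overpartition_gf"
    by (simp add: limit_gf_def overpartition_gf_def)
  have diff: "rat_of_int (int (av (n + 1) k B) - int (av n k B)) =
      fps_nth (fps_X ^ (n - 1) * (2 + 2 * fps_X) * overpartition_gf) k"
    if n: "real n \<ge> (real k + 7) / 2" for n k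
  proof -
    \<comment> \<open>The bound on \<open>n\<close> excludes \<open>n = 0\<close>, where
      \<open>n - 1\<close> would be truncated.\<close>
    have Suc: "fps_X ^ n = fps_X * (fps_X ^ (n - 1) :: rat fps)"
      using n by (cases n) auto
    define u y :: "rat fps" where "u = inverse (1 - fps_X)" and "y = fps_X ^ (n - 1)"
    have u: "u * (1 - fps_X) = 1"
      unfolding u_def by (rule inverse_mult_eq_1) simp
    \<comment> \<open>In the difference of the formulas for \<open>n + 1\<close> and
      \<open>n\<close>, a factor \<open>1 - fps_X\<close> appears and cancels the
      denominator.\<close>
    have "(1 - fps_X - fps_X * y * (2 + 2 * fps_X)) * u * overpartition_gf -
        (1 - fps_X - y * (2 + 2 * fps_X)) * u * overpartition_gf =
        y * (2 + 2 * fps_X) * overpartition_gf * (u * (1 - fps_X))"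
      by (simp add: algebra_simps)
    then have "(1 - fps_X - fps_X ^ n * (2 + 2 * fps_X)) / (1 - fps_X) * overpartition_gf -
        (1 - fps_X - fps_X ^ (n - 1) * (2 + 2 * fps_X)) / (1 - fps_X) * overpartition_gf =
        fps_X ^ (n - 1) * (2 + 2 * fps_X) * overpartition_gf"
      unfolding u Suc y_def[symmetric] by (simp add: fps_divide_unit u_def)
    then show ?thesis
      using av_gf[of k "n + 1"] av_gf[of k n] n by (simp add: B_def flip: fps_sub_nth)
  qed
  have nonneg: "fps_nth (fps_X ^ j * (2 + 2 * fps_X) * overpartition_gf) k \<ge> 0" for j k
  proof -
    have "0 \<le> fps_nth overpartition_gf i" for i
      by (simp add: overpartition_gf_def)
    moreover have eq: "fps_X ^ j * (2 + 2 * fps_X) * overpartition_gf =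
        fps_const 2 * (fps_X ^ j * (overpartition_gf + fps_X * overpartition_gf))"
      by (simp add: numeral_fps_const[symmetric] algebra_simps)
    ultimately show ?thesis
      unfolding eq by (simp add: fps_X_power_mult_nth)
  qed
  have "int (av (n + 1) k B) - int (av n k B) \<ge> 0" if "real n \<ge> (real k + 7) / 2" for n k
    using diff[OF that] nonneg[of "n - 1" k] by (metis of_int_0_le_iff)
  moreover have "has_limit_gf B" using ev unfolding has_limit_gf_def by blast
  moreover have "convergent_prod overpartition_factor"
    using has_prod_overpartition_factor unfolding convergent_prod_def has_prod_def by blast
  ultimately show ?thesis
    unfolding prodinf limit using diff av_gf[folded B_def] by blast
qed

end
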